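(* For any integers $k, L \geq 1$, there is a CNF formula $\Phi$ in which each clause contains $k$ variables, each variable appears in at most $L$ clauses, and which has a non-trivial implicate of size $j = k - \lfloor \log_2 L \rfloor$.
   Context: A clause is a disjunction of literals (a literal is a boolean variable or its negation); its size is its number of distinct literals, and the clause of size $0$ is the always-false clause. A CNF formula is a conjunction of clauses. For a boolean formula $\Phi$, a clause $C$ is a non-trivial implicate of $\Phi$ if $\Phi \models C$ (every assignment satisfying $\Phi$ also satisfies $C$) but $C$ is not a tautology.
   Formalization: The implicate's size is taken to be max(0, k − ⌊log₂ L⌋) instead of k − ⌊log₂ L⌋, since the latter is negative when L ≥ 2^(k+1) (for example k = 1, L = 4) and no clause has negative size. *)

theory Defs
  imports Complex_Main
begin

datatype 'v literal = Pos 'v | Neg 'v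

primrec lit_var :: "'v literal \<Rightarrow> 'v" where
  "lit_var (Pos x) = x"
| "lit_var (Neg x) = x"

primrec lit_true :: "('v \<Rightarrow> bool) \<Rightarrow> 'v literal \<Rightarrow> bool" where
  "lit_true \<alpha> (Pos x) \<longleftrightarrow> \<alpha> x"
| "lit_true \<alpha> (Neg x) \<longleftrightarrow> \<not> \<alpha> x"

text \<open>A clause is the set of its literals, so its size is its cardinality and the empty set is the
  always-false clause. Finiteness is not part of the types: it is required by
  \<open>is_clause\<close> and \<open>is_cnf\<close>.\<close>

type_synonym 'v clause = "'v literal set"
type_synonym 'v cnf = "'v clause set"

definition is_clause :: "'v clause \<Rightarrow> bool" where
  "is_clause C \<longleftrightarrow> finite C"

definition is_cnf :: "'v cnf \<Rightarrow> bool" where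
  "is_cnf \<Phi> \<longleftrightarrow> finite \<Phi> \<and> (\<forall>C\<in>\<Phi>. is_clause C)"

definition clause_size :: "'v clause \<Rightarrow> nat" where
  "clause_size C = card C"

definition clause_vars :: "'v clause \<Rightarrow> 'v set" where
  "clause_vars C = lit_var ` C"

definition clause_true :: "('v \<Rightarrow> bool) \<Rightarrow> 'v clause \<Rightarrow> bool" where
  "clause_true \<alpha> C \<longleftrightarrow> (\<exists>l\<in>C. lit_true \<alpha> l)"

definition cnf_true :: "('v \<Rightarrow> bool) \<Rightarrow> 'v cnf \<Rightarrow> bool" where
  "cnf_true \<alpha> \<Phi> \<longleftrightarrow> (\<forall>C\<in>\<Phi>. clause_true \<alpha> C)"

definition entails :: "'v cnf \<Rightarrow> 'v clause \<Rightarrow> bool" where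
  "entails \<Phi> C \<longleftrightarrow> (\<forall>\<alpha>. cnf_true \<alpha> \<Phi> \<longrightarrow> clause_true \<alpha> C)"

definition tautology :: "'v clause \<Rightarrow> bool" where
  "tautology C \<longleftrightarrow> (\<forall>\<alpha>. clause_true \<alpha> C)"

definition nontrivial_implicate :: "'v cnf \<Rightarrow> 'v clause \<Rightarrow> bool" where
  "nontrivial_implicate \<Phi> C \<longleftrightarrow> is_clause C \<and> entails \<Phi> C \<and> \<not> tautology C"

end

theory Submission
  imports Defs
begin

text \<open>Fix \<open>j\<close> variables, occurring positively in every clause, and append all \<open>2 ^ m\<close> sign patterns on
  \<open>m\<close> further variables, where \<open>j + m = k\<close> and \<open>2 ^ m \<le> L\<close>. An assignment falsifies one of the sign
  patterns, so it can only satisfy all the clauses by satisfying the common part. If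
  \<open>\<lfloor>log 2 L\<rfloor> > k\<close> then \<open>m = k\<close> already gives the empty implicate.\<close>

text \<open>\<open>S\<close> collects the negated variables, so that the literals over
  \<open>B\<close> are all false exactly under assignments true on \<open>S\<close> and false on
  \<open>B - S\<close>.\<close>

definition pattern_clause :: "'v set \<Rightarrow> 'v set \<Rightarrow> 'v set \<Rightarrow> 'v clause" where
  "pattern_clause A B S = Pos ` A \<union> Neg ` S \<union> Pos ` (B - S)"

lemma finite_pattern_clause:
  "finite A \<Longrightarrow> finite B \<Longrightarrow> S \<subseteq> B \<Longrightarrow> finite (pattern_clause A B S)"
  unfolding pattern_clause_def by (auto dest: finite_subset)

lemma clause_vars_pattern_clause:
  "S \<subseteq> B \<Longrightarrow> clause_vars (pattern_clause A B S) = A \<union> B"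
  unfolding clause_vars_def pattern_clause_def by (auto simp: image_Un image_image)

lemma entails_pattern_clauses: "entails (pattern_clause A B ` Pow B) (Pos ` A)"
  unfolding entails_def
proof (intro allI impI)
  fix \<alpha>
  assume "cnf_true \<alpha> (pattern_clause A B ` Pow B)"
  \<comment> \<open>This is the clause whose pattern over \<open>B\<close> is falsified by
    \<alpha>.\<close>
  then have "clause_true \<alpha> (pattern_clause A B {x \<in> B. \<alpha> x})"
    unfolding cnf_true_def by blast
  then show "clause_true \<alpha> (Pos ` A)"
    unfolding clause_true_def pattern_clause_def by auto
qed

lemma not_tautology_Pos: "\<not> tautology (Pos ` A)"
  unfolding tautology_def clause_true_def by (auto intro: exI[of _ "\<lambda>_. False"])

theorem proposition5p3:
  fixes k L :: nat
  assumes "k \<ge> 1" and "L \<ge> 1"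
  shows "\<exists>\<Phi> :: nat cnf. is_cnf \<Phi>
    \<and> (\<forall>C\<in>\<Phi>. card (clause_vars C) = k)
    \<and> (\<forall>x. card {C \<in> \<Phi>. x \<in> clause_vars C} \<le> L)
    \<and> (\<exists>D. nontrivial_implicate \<Phi> D
          \<and> int (clause_size D) = max 0 (int k - \<lfloor>log 2 (real L)\<rfloor>))"
proof -
  define m where "m = min k (nat \<lfloor>log 2 (real L)\<rfloor>)"
  define A where "A = {..<k - m}"
  define B where "B = {k - m..<k}"
  define \<Phi> where "\<Phi> = pattern_clause A B ` Pow B"
  define D :: "nat clause" where "D = Pos ` A"
  have log_nonneg: "0 \<le> log 2 (real L)"
    using assms(2) by simp
  have "real m \<le> log 2 (real L)"
    unfolding m_def using log_nonneg by linarith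
  then have "2 powr real m \<le> real L"
    using assms(2) by (simp add: le_log_iff)
  then have "real (2 ^ m) \<le> real L"
    by (simp add: powr_realpow)
  then have pow_le: "2 ^ m \<le> L"
    by (simp only: of_nat_le_iff)
  have fin: "finite A" "finite B" "finite \<Phi>"
    by (simp_all add: A_def B_def \<Phi>_def)
  \<comment> \<open>The cap \<open>m\<close> \<le> \<open>k\<close> makes the truncated difference
    \<open>k - (k - m)\<close> equal to \<open>m\<close>.\<close>
  have "card B = m"
    by (simp add: B_def m_def)
  then have "card \<Phi> \<le> 2 ^ m"
    using card_image_le[of "Pow B" "pattern_clause A B"] fin by (simp add: \<Phi>_def card_Pow)
  \<comment> \<open>Occurrences are bounded by the total number of clauses.\<close>
  then have occ: "card {C \<in> \<Phi>. x \<in> clause_vars C} \<le> L" for x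
    using card_mono[OF fin(3), of "{C \<in> \<Phi>. x \<in> clause_vars C}"] pow_le by auto
  have "A \<union> B = {..<k}"
    by (auto simp: A_def B_def)
  then have vars: "\<forall>C\<in>\<Phi>. card (clause_vars C) = k"
    by (auto simp: \<Phi>_def clause_vars_pattern_clause)
  have cnf: "is_cnf \<Phi>"
    using fin by (auto simp: is_cnf_def is_clause_def \<Phi>_def finite_pattern_clause)
  have implicate: "nontrivial_implicate \<Phi> D"
    using fin(1) entails_pattern_clauses not_tautology_Pos
    by (auto simp: nontrivial_implicate_def is_clause_def \<Phi>_def D_def)
  have "clause_size D = k - m"
    by (simp add: clause_size_def D_def A_def card_image inj_on_def)
  \<comment> \<open>The \<open>min\<close> in \<open>m\<close> turns into the \<open>max 0\<close>;
    \<open>nat\<close> is harmless as the logarithm is nonnegative.\<close>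
  then have "int (clause_size D) = max 0 (int k - \<lfloor>log 2 (real L)\<rfloor>)"
    unfolding m_def using log_nonneg by linarith
  with cnf vars occ implicate show ?thesis
    by blast
qed

end
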